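(* Let $m$ be a positive integer and let $T:[2m]\to[2m]$ be an endofunction, where $[2m]=\{1,\dots,2m\}$. Let $\sigma(2;T)$ be the number of $2$-splitting subsets for $T$ and let $g_T(t)=\sum_{i=0}^{2m}a_it^i$, where $a_i$ is the number of $T$-invariant subsets of $[2m]$ of cardinality $i$. If $\sigma(2;T)>0$, then $$\sigma(2;T)=g_T(-1).$$
   Context: Let $T$ be an endofunction on $[2m]$. A subset $W\subseteq[2m]$ of cardinality $m$ is called $2$-splitting for $T$ if $W\cup TW=[2m]$, where $TW$ is the image of $W$ under $T$. A subset $U\subseteq[2m]$ is $T$-invariant if $TU\subseteq U$; the empty set and the whole set are $T$-invariant. *)

theory Defs
  imports "HOL-Library.FuncSet" "HOL-Computational_Algebra.Polynomial"
begin

(* The ground set [2m] is {1..2*m} of type nat set.  All subsets below are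
   restricted to [2m], so values of T outside [2m] are irrelevant. *)

definition two_splitting :: "nat \<Rightarrow> (nat \<Rightarrow> nat) \<Rightarrow> nat set \<Rightarrow> bool" where
  "two_splitting m T W \<longleftrightarrow> W \<subseteq> {1..2*m} \<and> card W = m \<and> W \<union> T ` W = {1..2*m}"

definition invariant_subset :: "nat \<Rightarrow> (nat \<Rightarrow> nat) \<Rightarrow> nat set \<Rightarrow> bool" where
  "invariant_subset m T U \<longleftrightarrow> U \<subseteq> {1..2*m} \<and> T ` U \<subseteq> U"

definition sigma2 :: "nat \<Rightarrow> (nat \<Rightarrow> nat) \<Rightarrow> nat" where
  "sigma2 m T = card {W. two_splitting m T W}"

definition num_invariant :: "nat \<Rightarrow> (nat \<Rightarrow> nat) \<Rightarrow> nat \<Rightarrow> nat" where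
  "num_invariant m T i = card {U. invariant_subset m T U \<and> card U = i}"

definition inv_poly :: "nat \<Rightarrow> (nat \<Rightarrow> nat) \<Rightarrow> int poly" where
  "inv_poly m T = (\<Sum>i=0..2*m. monom (int (num_invariant m T i)) i)"

end

theory Submission
  imports Defs
begin

text \<open>
  Fix a splitting set \<open>W\<close>; then \<open>T\<close> maps \<open>W\<close> bijectively onto its complement. Call \<open>w \<in> W\<close> free
  in an invariant set \<open>U\<close> if \<open>T w \<in> U\<close> and \<open>w\<close> has no preimage in \<open>U\<close>. Adding or removing a free
  \<open>w\<close> keeps \<open>U\<close> invariant and, because \<open>T\<close> maps \<open>W\<close> into its complement, affects neither
  \<open>T w' \<in> U\<close> nor \<open>w' \<in> T ` U\<close> for \<open>w' \<in> W\<close>, so the set of free elements stays the same. Toggling the least free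
  element is thus a sign-reversing involution. In an invariant set without free elements, \<open>T\<close>
  pairs \<open>U \<inter> W\<close> with \<open>U - W\<close>, so these sets have even cardinality, and \<open>W' \<mapsto> sym_diff W W'\<close> is a
  bijection from the splitting sets onto them.
\<close>

definition free :: "(nat \<Rightarrow> nat) \<Rightarrow> nat set \<Rightarrow> nat set \<Rightarrow> nat set" where
  "free T W U = {w \<in> W. T w \<in> U \<and> w \<notin> T ` U}"

text \<open>Grouping the invariant sets by cardinality turns evaluation into a sum over sets; at
  \<open>-1\<close> each set contributes its sign.\<close>

lemma poly_inv_poly:
  "poly (inv_poly m T) x = (\<Sum>U | invariant_subset m T U. x ^ card U)"
proof -
  let ?S = "{U. invariant_subset m T U}"
  have "?S \<subseteq> Pow {1..2*m}" by (auto simp: invariant_subset_def)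
  then have fin: "finite ?S" by (rule finite_subset) simp
  have "card ` ?S \<subseteq> {0..2*m}"
    using card_mono[of "{1..2*m}"] by (fastforce simp: invariant_subset_def)
  then have "(\<Sum>U\<in>?S. x ^ card U) = (\<Sum>i=0..2*m. \<Sum>U | U \<in> ?S \<and> card U = i. x ^ card U)"
    using fin by (intro sum.group[symmetric]) auto
  also have "\<dots> = (\<Sum>i=0..2*m. int (num_invariant m T i) * x ^ i)"
    by (intro sum.cong) (auto simp: num_invariant_def)
  also have "\<dots> = poly (inv_poly m T) x"
    by (simp add: inv_poly_def poly_sum poly_monom)
  finally show ?thesis by simp
qed

text \<open>The image of \<open>W\<close> has at most \<open>m\<close> elements yet covers the
  complement of \<open>W\<close>, which has exactly \<open>m\<close>. So the two coincide, and no
  two elements of \<open>W\<close> can share an image.\<close>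

lemma
  assumes "two_splitting m T W"
  shows two_splitting_inj_on: "inj_on T W"
    and two_splitting_image: "T ` W = {1..2*m} - W"
proof -
  have W: "W \<subseteq> {1..2*m}" "card W = m" "W \<union> T ` W = {1..2*m}"
    using assms by (auto simp: two_splitting_def)
  have fin: "finite W" using W(1) by (rule finite_subset) simp
  have sub: "{1..2*m} - W \<subseteq> T ` W" using W(3) by blast
  have card: "card ({1..2*m} - W) = m" using W fin by (simp add: card_Diff_subset)
  have le: "card (T ` W) \<le> m" using card_image_le[OF fin] W(2) by metis
  then show eq: "T ` W = {1..2*m} - W"
    using card_seteq[of "T ` W", OF _ sub] fin card by simp
  show "inj_on T W"
    using eq card fin W(2) by (intro eq_card_imp_inj_on) auto
qed

lemma two_splittingI:
  assumes "W \<subseteq> {1..2*m}" "card W = m" "T \<in> {1..2*m} \<rightarrow> {1..2*m}" "{1..2*m} - W \<subseteq> T ` W"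
  shows "two_splitting m T W"
  using assms unfolding two_splitting_def by blast

lemma sum_free_eq_0:
  assumes split: "two_splitting m T W"
  shows "(\<Sum>U | invariant_subset m T U \<and> free T W U \<noteq> {}. (-1) ^ card U) = (0::int)"
    (is "sum ?f ?S = 0")
proof -
  define h where "h U = sym_diff U {LEAST w. w \<in> free T W U}" for U
  have im: "T ` W = {1..2*m} - W" by (rule two_splitting_image[OF split])
  have toggle: "h U \<in> ?S \<and> h (h U) = U \<and> ?f (h U) = - ?f U" if "U \<in> ?S" for U
  proof -
    define w where "w = (LEAST w. w \<in> free T W U)"
    have U: "U \<subseteq> {1..2*m}" "T ` U \<subseteq> U" using that by (auto simp: invariant_subset_def)
    have fin: "finite U" using U(1) by (rule finite_subset) simp
    have "free T W U \<noteq> {}" using that by simp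
    then obtain v where "v \<in> free T W U" by blast
    then have "w \<in> free T W U" unfolding w_def by (rule LeastI)
    then have w: "w \<in> W" "T w \<in> U" "w \<notin> T ` U" by (auto simp: free_def)
    have Tne: "T v \<noteq> w" if "v \<in> W" for v using im that w(1) by blast
    have hU: "h U = sym_diff U {w}" by (simp add: h_def w_def)
    have inv: "invariant_subset m T (h U)"
      using U w Tne[OF w(1)] split by (auto simp: hU invariant_subset_def two_splitting_def)
    have free_eq: "free T W (h U) = free T W U"
      using Tne w(1) im by (auto simp: hU free_def)
    \<comment> \<open>The free elements are unchanged, so the second toggle picks the same least
      one.\<close>
    have "h (h U) = sym_diff (h U) {w}" by (simp only: h_def[of "h U"] free_eq w_def)
    also have "\<dots> = U" by (auto simp: hU)
    finally have "h (h U) = U" .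
    moreover have "?f (h U) = - ?f U"
    proof (cases "w \<in> U")
      case True
      have "card U = Suc (card (U - {w}))" by (rule card.remove[OF fin True])
      moreover have "h U = U - {w}" using True by (auto simp: hU)
      ultimately show ?thesis by simp
    next
      case False
      then have "h U = insert w U" by (auto simp: hU)
      then show ?thesis using False fin by simp
    qed
    ultimately show ?thesis using inv free_eq that by simp
  qed
  \<comment> \<open>Reindexing along the involution makes the sum equal to its own negative.\<close>
  have "sum ?f ?S = (\<Sum>U\<in>?S. - ?f U)"
    by (rule sum.reindex_bij_witness[where i = h and j = h]) (use toggle in auto)
  then show ?thesis by (simp add: sum_negf)
qed

lemma
  assumes split: "two_splitting m T W" and inv: "invariant_subset m T U"
    and free: "free T W U = {}"
  shows not_free_image: "T ` (U \<inter> W) = U - W"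
    and not_free_image_compl: "T ` (U - W) = U \<inter> W"
    and not_free_card: "card (U - W) = card (U \<inter> W)"
proof -
  note im = two_splitting_image[OF split] and inj = two_splitting_inj_on[OF split]
  have U: "U \<subseteq> {1..2*m}" "T ` U \<subseteq> U" using inv by (auto simp: invariant_subset_def)
  have fin: "finite U" using U(1) by (rule finite_subset) simp
  have mem: "w \<in> T ` U" if "w \<in> W" "T w \<in> U" for w using free that by (auto simp: free_def)
  show im1: "T ` (U \<inter> W) = U - W"
  proof
    show "T ` (U \<inter> W) \<subseteq> U - W" using U im by blast
    show "U - W \<subseteq> T ` (U \<inter> W)"
    proof
      fix u assume u: "u \<in> U - W"
      then obtain w where w: "w \<in> W" "u = T w" using U(1) im by blast
      \<comment> \<open>Since \<open>T w\<close> lies in \<open>U\<close> and \<open>w\<close> is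
        not free, \<open>w\<close> is an image of a point of \<open>U\<close>.\<close>
      then have "w \<in> U" using mem u U(2) by blast
      then show "u \<in> T ` (U \<inter> W)" using w by blast
    qed
  qed
  show card: "card (U - W) = card (U \<inter> W)"
    unfolding im1[symmetric] by (rule card_image) (use inj in \<open>auto intro: inj_on_subset\<close>)
  \<comment> \<open>A preimage of a point of \<open>W\<close> lies outside \<open>W\<close>, as
    \<open>T\<close> maps \<open>W\<close> into its complement. Counting then forces
    equality.\<close>
  have "U \<inter> W \<subseteq> T ` (U - W)" using mem U(2) im by blast
  moreover have "card (T ` (U - W)) \<le> card (U \<inter> W)"
    using card_image_le[of "U - W" T] fin card by simp
  ultimately show "T ` (U - W) = U \<inter> W"
    using card_seteq[of "T ` (U - W)" "U \<inter> W"] fin by simp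
qed

text \<open>Passing to the symmetric difference trades \<open>U \<inter> W\<close> for
  \<open>U - W\<close>, which has the same size. A point of the ground set outside the new set has a
  preimage in \<open>U - W\<close> if it lies in \<open>U\<close>, and in \<open>W - U\<close>
  otherwise.\<close>

lemma two_splitting_sym_diff:
  assumes T: "T \<in> {1..2*m} \<rightarrow> {1..2*m}" and split: "two_splitting m T W"
    and inv: "invariant_subset m T U" and free: "free T W U = {}"
  shows "two_splitting m T (sym_diff W U)"
proof (rule two_splittingI[OF _ _ T])
  note im = two_splitting_image[OF split]
  note nf = not_free_image[OF split inv free] not_free_image_compl[OF split inv free]
    not_free_card[OF split inv free]
  have W: "W \<subseteq> {1..2*m}" "card W = m" using split by (auto simp: two_splitting_def)
  have U: "U \<subseteq> {1..2*m}" using inv by (auto simp: invariant_subset_def)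
  have fin: "finite W" "finite U" using W(1) U by (auto intro: finite_subset)
  show "sym_diff W U \<subseteq> {1..2*m}" using W(1) U by blast
  have "card (sym_diff W U) = card (W - U) + card (U - W)"
    using fin by (intro card_Un_disjoint) auto
  also have "\<dots> = card (W - U) + card (W \<inter> U)" using nf(3) by (simp add: Int_commute)
  also have "\<dots> = m" using card_Diff_subset_Int[of W U] card_mono[of W "W \<inter> U"] fin W(2) by simp
  finally show "card (sym_diff W U) = m" .
  show "{1..2*m} - sym_diff W U \<subseteq> T ` sym_diff W U"
  proof
    fix x assume x: "x \<in> {1..2*m} - sym_diff W U"
    show "x \<in> T ` sym_diff W U"
    proof (cases "x \<in> U")
      case True
      then have "x \<in> T ` (U - W)" using x nf(2) by blast
      then show ?thesis by blast
    next
      case False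
      then obtain w where w: "w \<in> W" "x = T w" using x im by blast
      then have "w \<notin> U" using nf(1) False by blast
      then show ?thesis using w by blast
    qed
  qed
qed

text \<open>A point of \<open>W - W'\<close> has a preimage in \<open>W'\<close>, which is not in
  \<open>W\<close> because \<open>T\<close> maps \<open>W\<close> off itself; the other case is
  symmetric. So the symmetric difference lies in its own image, and finiteness gives
  equality.\<close>

lemma sym_diff_two_splitting:
  assumes split: "two_splitting m T W" and split': "two_splitting m T W'"
  shows "invariant_subset m T (sym_diff W W')" and "free T W (sym_diff W W') = {}"
proof -
  let ?U = "sym_diff W W'"
  note im = two_splitting_image[OF split] and im' = two_splitting_image[OF split']
  have W: "W \<subseteq> {1..2*m}" "W' \<subseteq> {1..2*m}" using split split' by (auto simp: two_splitting_def)
  have fin: "finite ?U" using W by (auto intro: finite_subset)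
  have sub: "?U \<subseteq> T ` ?U"
  proof
    fix u assume "u \<in> ?U"
    then consider "u \<in> W" "u \<notin> W'" | "u \<in> W'" "u \<notin> W" by blast
    then show "u \<in> T ` ?U"
    proof cases
      case 1
      then obtain v where "v \<in> W'" "u = T v" using im' W by blast
      moreover from this have "v \<notin> W" using 1 im by blast
      ultimately show ?thesis by blast
    next
      case 2
      then obtain v where "v \<in> W" "u = T v" using im W by blast
      moreover from this have "v \<notin> W'" using 2 im' by blast
      ultimately show ?thesis by blast
    qed
  qed
  then have eq: "T ` ?U = ?U"
    using card_seteq[of "T ` ?U" ?U] card_image_le[of ?U T] fin by blast
  then show "invariant_subset m T ?U" using W by (auto simp: invariant_subset_def)
  \<comment> \<open>\<open>T w\<close> is not in \<open>W\<close>, hence is in \<open>W'\<close>,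
    which forces \<open>w\<close> out of \<open>W'\<close>.\<close>
  have "w \<in> ?U" if "w \<in> W" "T w \<in> ?U" for w using that im im' by blast
  then show "free T W ?U = {}" using eq by (auto simp: free_def)
qed

theorem theorem2p3:
  fixes m :: nat and T :: "nat \<Rightarrow> nat"
  assumes "m \<ge> 1"
    and "T \<in> {1..2*m} \<rightarrow> {1..2*m}"
    and "sigma2 m T > 0"
  shows "int (sigma2 m T) = poly (inv_poly m T) (-1)"
proof -
  obtain W where split: "two_splitting m T W"
    using assms(3) unfolding sigma2_def by (metis card.empty empty_Collect_eq less_irrefl)
  let ?I = "{U. invariant_subset m T U}"
  let ?F = "{U. invariant_subset m T U \<and> free T W U \<noteq> {}}"
  let ?N = "{U. invariant_subset m T U \<and> free T W U = {}}"
  have "?I \<subseteq> Pow {1..2*m}" by (auto simp: invariant_subset_def)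
  then have fin: "finite ?I" by (rule finite_subset) simp
  have "even (card U)" if "U \<in> ?N" for U
  proof -
    have "finite U" using that by (auto simp: invariant_subset_def intro: finite_subset)
    then have "card U = card (U \<inter> W) + card (U - W)" by (simp add: card_Int_Diff)
    then show ?thesis using not_free_card[OF split, of U] that by simp
  qed
  then have sum_N: "(\<Sum>U\<in>?N. (-1) ^ card U) = int (card ?N)" by simp
  have "bij_betw (\<lambda>W'. sym_diff W W') {W'. two_splitting m T W'} ?N"
  \<comment> \<open>Symmetric difference with the fixed \<open>W\<close> is its own inverse.\<close>
  proof (rule bij_betw_byWitness[where f' = "\<lambda>U. sym_diff W U"])
    show "(\<lambda>W'. sym_diff W W') ` {W'. two_splitting m T W'} \<subseteq> ?N"
      using sym_diff_two_splitting[OF split] by blast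
    show "(\<lambda>U. sym_diff W U) ` ?N \<subseteq> {W'. two_splitting m T W'}"
      using two_splitting_sym_diff[OF assms(2) split] by blast
  qed auto
  then have "sigma2 m T = card ?N" unfolding sigma2_def by (rule bij_betw_same_card)
  moreover have "(\<Sum>U\<in>?I. (-1) ^ card U) = (\<Sum>U\<in>?F. (-1) ^ card U) + (\<Sum>U\<in>?N. (-1::int) ^ card U)"
    using fin by (subst sum.union_disjoint[symmetric]) (auto intro!: sum.cong)
  ultimately show ?thesis
    using sum_free_eq_0[OF split] sum_N by (simp add: poly_inv_poly)
qed

end
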